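(* For every integer $k\geq 1$, \[ H_{B(WB)^k}(x) = H_{W(BW)^k}(x), \] where $B(WB)^k$ denotes the necklace obtained from the word consisting of the letter $B$ followed by $k$ copies of $WB$, and $W(BW)^k$ the necklace obtained from the word consisting of $W$ followed by $k$ copies of $BW$.
   Context: Bulgarian Solitaire: a partition $\lambda$ of $n$ is mapped to $\beta(\lambda)$, obtained by removing one from each part of $\lambda$ (discarding parts that become $0$), adding a new part equal to the number of parts of $\lambda$, and sorting in weakly decreasing order (in Young diagram terms: remove the first column and reinsert it as a row). A necklace is an equivalence class of finite words in the letters $\{B,W\}$ under cyclic rotation; it is primitive if it is not of the form $N^m=NN\cdots N$ with $m\geq 2$. Given a word $b=(b_1,\dots,b_m)$ with $r$ letters $B$, put $n=\binom{m}{2}+r$ and associate to $b$ the partition $(m-1+s_1,m-2+s_2,\ldots,0+s_m)$ of $n$ (zero parts discarded), where $s_i=1$ if $b_i=B$ and $s_i=0$ if $b_i=W$. For a necklace $N$, let $\mathcal{C}_N$ be the set of partitions associated to the words in the rotation class of $N$ (these form a cycle of $\beta$), and let the orbit $\mathcal{O}_N$ be the set of partitions $\lambda$ of $n$ with $\beta^k(\lambda)\in\mathcal{C}_N$ for some $k\geq 1$. For $\lambda\in\mathcal{O}_N$ let $\mathrm{level}(\lambda)=\min\{k\geq 0:\beta^k(\lambda)\in\mathcal{C}_N\}$ and $\mathcal{D}_N(x)=\sum_{\lambda\in\mathcal{O}_N}x^{\mathrm{level}(\lambda)}$. For a primitive necklace $P$, $P^\ell$ denotes the concatenation of $\ell$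 copies of $P$, and $H_P(x)=\lim_{\ell\to\infty}\mathcal{D}_{P^\ell}(x)$, the limit being taken coefficientwise as formal power series (its existence is known from prior work). *)

theory Defs
  imports "HOL-Library.Multiset" "HOL-Computational_Algebra.Formal_Power_Series"
begin

section \<open>Bulgarian Solitaire\<close>

text \<open>
  A partition is represented by the multiset of its (positive) parts, so the sorting step of
  the game is implicit.
\<close>

definition is_partition :: "nat \<Rightarrow> nat multiset \<Rightarrow> bool" where
  "is_partition n p \<longleftrightarrow> 0 \<notin># p \<and> sum_mset p = n"

text \<open>The outer filter also discards the new part in the degenerate case of the empty partition.\<close>

definition bulgarian :: "nat multiset \<Rightarrow> nat multiset" where
  "bulgarian p = filter_mset (\<lambda>x. x > 0) (add_mset (size p) (image_mset (\<lambda>x. x - 1) p))"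


section \<open>Necklaces\<close>

datatype letter = B | W

type_synonym word = "letter list"

definition rotation_rel :: "(word \<times> word) set" where
  "rotation_rel = {(u, v). \<exists>i. v = rotate i u}"

type_synonym necklace = "word set"

definition necklace :: "word \<Rightarrow> necklace" where
  "necklace w = rotation_rel `` {w}"

definition word_power :: "word \<Rightarrow> nat \<Rightarrow> word" where
  "word_power w l = concat (replicate l w)"

definition necklace_power :: "necklace \<Rightarrow> nat \<Rightarrow> necklace" where
  "necklace_power N l = (\<Union>w\<in>N. necklace (word_power w l))"

lemma equiv_rotation_rel: "equiv UNIV rotation_rel"
proof (rule equivI)
  show "refl rotation_rel"
    unfolding refl_on_def rotation_rel_def by (metis (mono_tags, lifting) case_prodI mem_Collect_eq rotate0 id_apply)
  show "sym rotation_rel"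
  proof (rule symI)
    fix u v :: word assume "(u, v) \<in> rotation_rel"
    then obtain i where v: "v = rotate i u" by (auto simp: rotation_rel_def)
    have "u = rotate (length u - i mod length u) v"
    proof (cases "u = []")
      case False
      then have "i mod length u \<le> length u" by (simp add: less_imp_le)
      then have "rotate (length u - i mod length u) (rotate (i mod length u) u) = u"
        by (simp add: rotate_rotate)
      then show ?thesis using v rotate_conv_mod[of i u] by simp
    qed (simp add: v)
    then show "(v, u) \<in> rotation_rel" unfolding rotation_rel_def by blast
  qed
  show "trans rotation_rel"
    unfolding trans_def rotation_rel_def by (auto simp: rotate_rotate)
qed simp

lemma word_power_rotate: "word_power (rotate i w) l = rotate i (word_power w l)"
proof (induction i)
  case (Suc i)
  have shift: "concat (replicate l (xs @ [a])) @ xs = xs @ concat (replicate l (a # xs))"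
    for l and a :: letter and xs by (induction l) auto
  have "word_power (rotate1 u) l = rotate1 (word_power u l)" for u
  proof (cases u)
    case (Cons a xs)
    show ?thesis
    proof (cases l)
      case (Suc l')
      have "concat (replicate l (xs @ [a])) = concat (replicate l' (xs @ [a])) @ xs @ [a]"
        by (subst Suc, subst replicate_Suc, subst replicate_append_same[symmetric]) simp
      also have "\<dots> = xs @ concat (replicate l' (a # xs)) @ [a]"
        using shift[of l' xs a] by (metis append.assoc)
      finally show ?thesis using Suc Cons by (simp add: word_power_def)
    qed (simp add: word_power_def)
  qed (simp add: word_power_def)
  with Suc show ?case by simp
qed simp

lemma necklace_power_necklace: "necklace_power (necklace w) l = necklace (word_power w l)"
proof -
  have "necklace (word_power v l) = necklace (word_power w l)" if "v \<in> necklace w" for v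
  proof -
    from that obtain i where "v = rotate i w" by (auto simp: necklace_def rotation_rel_def)
    then have "(word_power w l, word_power v l) \<in> rotation_rel"
      by (auto simp: rotation_rel_def word_power_rotate)
    then show ?thesis
      unfolding necklace_def using equiv_class_eq[OF equiv_rotation_rel] by blast
  qed
  moreover have "w \<in> necklace w"
    by (auto simp: necklace_def rotation_rel_def intro: exI[of _ 0])
  ultimately show ?thesis unfolding necklace_power_def by blast
qed


section \<open>Cycles, orbits and their level generating functions\<close>

definition word_weight :: "word \<Rightarrow> nat" where
  "word_weight w = (length w choose 2) + count_list w B"

text \<open>Positions are counted from 0, so position i contributes the part m - 1 - i + s.\<close>

definition word_partition :: "word \<Rightarrow> nat multiset" where
  "word_partition w = filter_mset (\<lambda>x. x > 0)
     (mset (map (\<lambda>i. length w - 1 - i + (if w ! i = B then 1 else 0)) [0..<length w]))"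

definition cycle :: "necklace \<Rightarrow> nat multiset set" where
  "cycle N = word_partition ` N"

text \<open>All words of a necklace have the same weight, so the choice of w below is immaterial.\<close>

definition orbit :: "necklace \<Rightarrow> nat multiset set" where
  "orbit N = {p. (\<exists>w\<in>N. is_partition (word_weight w) p) \<and>
                 (\<exists>k\<ge>1. (bulgarian ^^ k) p \<in> cycle N)}"

definition level :: "necklace \<Rightarrow> nat multiset \<Rightarrow> nat" where
  "level N p = (LEAST k. (bulgarian ^^ k) p \<in> cycle N)"

definition level_gf :: "necklace \<Rightarrow> int fps" where
  "level_gf N = (\<Sum>p\<in>orbit N. fps_X ^ level N p)"

text \<open>
  The limit is coefficientwise; as the coefficients are integers, convergence means that each
  coefficient is eventually constant. The limit is known to exist for primitive \<open>P\<close>, which is the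
  only case in which this function is meaningful.
\<close>

definition limit_gf :: "necklace \<Rightarrow> int fps" where
  "limit_gf P = Abs_fps (\<lambda>i. lim (\<lambda>l. fps_nth (level_gf (necklace_power P l)) i))"

lemma word_weight_necklace: "v \<in> necklace w \<Longrightarrow> word_weight v = word_weight w"
proof -
  have count: "count_list (rotate1 u) B = count_list u B" for u by (cases u) auto
  have "word_weight (rotate i w) = word_weight w" for i
    by (induction i) (auto simp: word_weight_def count)
  then show "v \<in> necklace w \<Longrightarrow> word_weight v = word_weight w"
    by (auto simp: necklace_def rotation_rel_def)
qed

lemma finite_partitions: "finite {p. is_partition n p}"
proof (rule finite_subset)
  show "{p. is_partition n p} \<subseteq> mset ` {xs. set xs \<subseteq> {..n} \<and> length xs \<le> n}"
  proof
    fix p assume "p \<in> {p. is_partition n p}"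
    then have p: "0 \<notin># p" "sum_mset p = n" by (auto simp: is_partition_def)
    obtain xs where xs: "p = mset xs" by (metis ex_mset)
    have "length xs \<le> sum_list xs" if "0 \<notin> set xs" for xs :: "nat list"
      using that by (induction xs) auto
    moreover have "x \<le> sum_list xs" if "x \<in> set xs" for x
      using that by (simp add: member_le_sum_list)
    ultimately show "p \<in> mset ` {xs. set xs \<subseteq> {..n} \<and> length xs \<le> n}"
      using p xs by (auto simp: sum_mset_sum_list)
  qed
qed (simp add: finite_lists_length_le)

lemma finite_orbit: "finite (orbit (necklace w))"
  by (rule finite_subset[OF _ finite_partitions[of "word_weight w"]])
     (auto simp: orbit_def word_weight_necklace)

end

theory Submission
  imports Defs
begin

text \<open>
  A move of the solitaire is undone by choosing a part \<open>a\<close> with \<open>a + 1\<close> at least the number of parts,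
  deleting it and inserting it as a first column. Subtracting the number of undone moves from all
  parts, the backward plays of length \<open>i\<close> from a partition far larger than \<open>i\<close> become the sequences of
  parts, chosen without replacement, in which each part is at least its predecessor minus 2. Their
  number depends only on which parts coincide and which exceed others by more than 2.

  The necklace of \<open>W(BW)\<^sup>k\<close> contains \<open>W(WB)\<^sup>k\<close>, which differs from \<open>B(WB)\<^sup>k\<close> in the first letter
  only. Flipping this letter in every period affects neither relation between the parts, so
  corresponding elements of the two cycles have equally many backward plays of each length that is
  small compared to \<open>\<ell>\<close>. The coefficients of the level generating functions hence agree eventually, and
  so do their limits, whether or not these exist.
\<close>

section \<open>Preimages\<close>

text \<open>Ones fill up the inserted column to height \<open>a\<close>; the truncated difference
  achieves this only if \<open>size q \<le> Suc a\<close>.\<close>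

definition unplay :: "nat multiset \<Rightarrow> nat \<Rightarrow> nat multiset" where
  "unplay q a = image_mset Suc (q - {#a#}) + replicate_mset (Suc a - size q) 1"

lemma size_unplay: "a \<in># q \<Longrightarrow> size q \<le> Suc a \<Longrightarrow> size (unplay q a) = a"
  by (cases "size q") (auto simp: unplay_def size_Diff_singleton)

lemma zero_notin_unplay: "0 \<notin># unplay q a"
  by (auto simp: unplay_def)

lemma bulgarian_unplay:
  assumes "a \<in># q" "size q \<le> Suc a" "0 \<notin># q"
  shows "bulgarian (unplay q a) = q"
proof -
  have "a > 0" using assms by (metis gr0I)
  have pos: "filter_mset ((<) 0) q = q"
    unfolding filter_mset_eq_conv using assms(3) by (auto intro: gr0I)
  have zeros: "filter_mset ((<) 0) (replicate_mset j (0 :: nat)) = {#}" for j :: nat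
    by (auto simp: filter_mset_eq_conv)
  have "image_mset (\<lambda>x. x - 1) (unplay q a) = q - {#a#} + replicate_mset (Suc a - size q) 0"
    by (simp add: unplay_def multiset.map_comp o_def)
  then show ?thesis
    using size_unplay[OF assms(1,2)] assms(1) \<open>a > 0\<close> pos
    by (simp add: bulgarian_def zeros del: diff_union_swap2 filter_diff_mset)
qed

text \<open>Lowering every part loses exactly the parts equal to 1, so the drop in size counts
  them.\<close>

lemma mset_eq_Suc_positive_parts:
  assumes "0 \<notin># (p :: nat multiset)"
  shows "p = image_mset Suc (filter_mset (\<lambda>x. x > 0) (image_mset (\<lambda>x. x - 1) p)) +
    replicate_mset (size p - size (filter_mset (\<lambda>x. x > 0) (image_mset (\<lambda>x. x - 1) p))) 1"
  using assms
proof (induction p)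
  case (add x p)
  let ?f = "\<lambda>p :: nat multiset. filter_mset (\<lambda>x. x > 0) (image_mset (\<lambda>x. x - 1) p)"
  have "size (?f p) \<le> size p"
    by (metis size_filter_mset_lesseq size_image_mset)
  with add show ?case by (auto simp: Suc_diff_le)
qed simp

text \<open>The row inserted by a move has length \<open>size p\<close>, so this is the part whose
  choice undoes the move.\<close>

lemma unplay_size_bulgarian:
  assumes "0 \<notin># p" "p \<noteq> {#}"
  shows "size p \<in># bulgarian p" "size (bulgarian p) \<le> Suc (size p)"
    "unplay (bulgarian p) (size p) = p"
proof -
  let ?f = "filter_mset (\<lambda>x. x > 0) (image_mset (\<lambda>x. x - 1) p)"
  have b: "bulgarian p = add_mset (size p) ?f"
    using assms(2) by (simp add: bulgarian_def nonempty_has_size)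
  show "size p \<in># bulgarian p" by (simp add: b)
  show "size (bulgarian p) \<le> Suc (size p)"
    using size_filter_mset_lesseq[of "\<lambda>x. x > 0" "image_mset (\<lambda>x. x - 1) p"] by (simp add: b)
  show "unplay (bulgarian p) (size p) = p"
    using mset_eq_Suc_positive_parts[OF assms(1)] by (simp add: b unplay_def)
qed

lemma zero_notin_bulgarian: "0 \<notin># bulgarian p"
  by (auto simp: bulgarian_def)

lemma zero_notin_funpow_bulgarian: "0 \<notin># p \<Longrightarrow> 0 \<notin># (bulgarian ^^ i) p"
  by (cases i) (auto simp: zero_notin_bulgarian)

lemma sum_bulgarian: "0 \<notin># p \<Longrightarrow> sum_mset (bulgarian p) = sum_mset p"
proof -
  have filter: "sum_mset (filter_mset (\<lambda>x. x > 0) q) = sum_mset q" for q :: "nat multiset"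
    by (induction q) auto
  assume "0 \<notin># p"
  then have "size p + sum_mset (image_mset (\<lambda>x. x - 1) p) = sum_mset p"
    by (induction p) auto
  then show ?thesis by (simp add: bulgarian_def filter)
qed

lemma sum_funpow_bulgarian: "0 \<notin># p \<Longrightarrow> sum_mset ((bulgarian ^^ i) p) = sum_mset p"
  by (induction i) (auto simp: sum_bulgarian zero_notin_funpow_bulgarian)

text \<open>\<open>unplay q\<close> and \<open>size\<close> are inverse to each other here. For
  \<open>q = {#}\<close> this fails: it is its own preimage but has no part to choose.\<close>

lemma preimages_bulgarian:
  assumes "0 \<notin># q" "q \<noteq> {#}"
  shows "{p. 0 \<notin># p \<and> bulgarian p = q} = unplay q ` {a \<in> set_mset q. size q \<le> Suc a}"
proof (intro equalityI subsetI)
  fix p assume p: "p \<in> {p. 0 \<notin># p \<and> bulgarian p = q}"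
  then have "p \<noteq> {#}" using assms(2) by (auto simp: bulgarian_def)
  with p show "p \<in> unplay q ` {a \<in> set_mset q. size q \<le> Suc a}"
    using unplay_size_bulgarian[of p] by (auto intro!: image_eqI[of _ _ "size p"])
qed (use assms in \<open>auto simp: bulgarian_unplay zero_notin_unplay\<close>)

definition ancestors :: "nat \<Rightarrow> nat multiset \<Rightarrow> nat multiset set" where
  "ancestors i q = {p. 0 \<notin># p \<and> (bulgarian ^^ i) p = q}"

lemma finite_ancestors: "finite (ancestors i q)"
  by (rule finite_subset[OF _ finite_partitions[of "sum_mset q"]])
     (auto simp: ancestors_def is_partition_def sum_funpow_bulgarian)

lemma card_ancestors_Suc:
  assumes "0 \<notin># q" "q \<noteq> {#}"
  shows "card (ancestors (Suc i) q) =
    (\<Sum>a\<in>{a \<in> set_mset q. size q \<le> Suc a}. card (ancestors i (unplay q a)))"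
proof -
  let ?A = "{a \<in> set_mset q. size q \<le> Suc a}"
  have "ancestors (Suc i) q = (\<Union>r\<in>{r. 0 \<notin># r \<and> bulgarian r = q}. ancestors i r)"
    by (auto simp: ancestors_def zero_notin_funpow_bulgarian)
  also have "\<dots> = (\<Union>a\<in>?A. ancestors i (unplay q a))"
    by (simp add: preimages_bulgarian[OF assms])
  also have "card \<dots> = (\<Sum>a\<in>?A. card (ancestors i (unplay q a)))"
  proof (rule card_UN_disjoint)
    have "inj_on (unplay q) ?A"
      by (rule inj_on_inverseI[of _ size]) (auto simp: size_unplay)
    then show "\<forall>a\<in>?A. \<forall>b\<in>?A. a \<noteq> b \<longrightarrow> ancestors i (unplay q a) \<inter> ancestors i (unplay q b) = {}"
      by (auto simp: ancestors_def inj_on_def)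
  qed (auto simp: finite_ancestors)
  finally show ?thesis .
qed


section \<open>Counting backward plays\<close>

text \<open>
  The parts are shifted as described above, and \<open>c\<close> is the part chosen by the preceding undone move,
  which for the first move is the number of parts plus 1.
\<close>

primrec plays :: "nat \<Rightarrow> nat multiset \<Rightarrow> nat \<Rightarrow> nat" where
  "plays 0 M c = 1"
| "plays (Suc i) M c = (\<Sum>v\<in>{v \<in> set_mset M. c \<le> v + 2}. plays i (M - {#v#}) v)"

text \<open>Each choice lies at most 2 below its predecessor, so \<open>i\<close> moves never reach
  a part below \<open>c - 2 * i\<close>.\<close>

lemma plays_cong_large:
  "filter_mset (\<lambda>v. c \<le> v + 2 * i) M = filter_mset (\<lambda>v. c \<le> v + 2 * i) M' \<Longrightarrow>
   plays i M c = plays i M' c"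
proof (induction i arbitrary: M M' c)
  case (Suc i)
  let ?P = "\<lambda>v. c \<le> v + 2 * Suc i"
  have set: "{v \<in> set_mset M. c \<le> v + 2} = {v \<in> set_mset M'. c \<le> v + 2}"
  proof -
    have "v \<in># M \<longleftrightarrow> v \<in># M'" if "c \<le> v + 2" for v
      using arg_cong[OF Suc.prems, of "\<lambda>N. v \<in># N"] that by simp
    then show ?thesis by blast
  qed
  have "plays i (M - {#v#}) v = plays i (M' - {#v#}) v" if v: "c \<le> v + 2" for v
  proof (rule Suc.IH)
    have "filter_mset (\<lambda>x. v \<le> x + 2 * i) (N - {#v#}) =
          filter_mset (\<lambda>x. v \<le> x + 2 * i) (filter_mset ?P N - {#v#})" for N
      using v by (intro multiset_eqI) auto
    then show "filter_mset (\<lambda>x. v \<le> x + 2 * i) (M - {#v#}) =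
               filter_mset (\<lambda>x. v \<le> x + 2 * i) (M' - {#v#})"
      using Suc.prems by metis
  qed
  then show ?case unfolding plays.simps set by (intro sum.cong) auto
qed simp

text \<open>The recursion sees the parts only through equality and the test
  \<open>u \<le> v + 2\<close>, and \<open>f\<close> respects both.\<close>

lemma plays_image:
  assumes "inj_on f (insert c (set_mset M))"
    and "\<And>u v. u \<in> insert c (set_mset M) \<Longrightarrow> v \<in> set_mset M \<Longrightarrow> f u \<le> f v + 2 \<longleftrightarrow> u \<le> v + 2"
  shows "plays i (image_mset f M) (f c) = plays i M c"
  using assms
proof (induction i arbitrary: M c)
  case (Suc i)
  let ?S = "{v \<in> set_mset M. c \<le> v + 2}"
  have sub: "set_mset (M - {#v#}) \<subseteq> set_mset M" for v
    by (auto dest: in_diffD)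
  have "{v \<in> set_mset (image_mset f M). f c \<le> v + 2} = f ` ?S"
    using Suc.prems(2)[of c] by auto
  moreover have "inj_on f ?S"
    using Suc.prems(1) by (rule inj_on_subset) auto
  moreover have "plays i (image_mset f M - {#f v#}) (f v) = plays i (M - {#v#}) v" if "v \<in> ?S" for v
  proof -
    have "image_mset f M - {#f v#} = image_mset f (M - {#v#})"
      using that by (simp add: image_mset_Diff)
    moreover have "plays i (image_mset f (M - {#v#})) (f v) = plays i (M - {#v#}) v"
    proof (rule Suc.IH)
      show "inj_on f (insert v (set_mset (M - {#v#})))"
        using Suc.prems(1) by (rule inj_on_subset) (use sub that in auto)
      show "f u \<le> f w + 2 \<longleftrightarrow> u \<le> w + 2"
        if "u \<in> insert v (set_mset (M - {#v#}))" "w \<in> set_mset (M - {#v#})" for u w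
        using Suc.prems(2) that sub \<open>v \<in> ?S\<close> by blast
    qed
    ultimately show ?thesis by simp
  qed
  ultimately show ?case by (simp add: sum.reindex)
qed simp

text \<open>By \<open>eq\<close>, sending \<open>x a\<close> to \<open>y a\<close> is well defined
  and injective, which reduces the claim to an image. The index \<open>z\<close> lets the preceding
  choice be compared like a part.\<close>

lemma plays_cong_indexed:
  fixes x y :: "'i \<Rightarrow> nat"
  assumes "finite I"
    and eq: "\<And>a b. a \<in> insert z I \<Longrightarrow> b \<in> insert z I \<Longrightarrow> x a = x b \<longleftrightarrow> y a = y b"
    and le: "\<And>a b. a \<in> insert z I \<Longrightarrow> b \<in> insert z I \<Longrightarrow> x a \<le> x b + 2 \<longleftrightarrow> y a \<le> y b + 2"
  shows "plays i (image_mset x (mset_set I)) (x z) = plays i (image_mset y (mset_set I)) (y z)"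
proof -
  define f where "f v = y (SOME a. a \<in> insert z I \<and> x a = v)" for v
  have f: "f (x a) = y a" if "a \<in> insert z I" for a
    unfolding f_def using someI[of "\<lambda>b. b \<in> insert z I \<and> x b = x a" a] that eq by auto
  have "plays i (image_mset f (image_mset x (mset_set I))) (f (x z)) =
        plays i (image_mset x (mset_set I)) (x z)"
  proof (rule plays_image)
    have S: "insert (x z) (set_mset (image_mset x (mset_set I))) = x ` insert z I"
      using assms(1) by simp
    show "inj_on f (insert (x z) (set_mset (image_mset x (mset_set I))))"
      unfolding S using f eq by (auto simp: inj_on_def)
    show "f u \<le> f v + 2 \<longleftrightarrow> u \<le> v + 2"
      if "u \<in> insert (x z) (set_mset (image_mset x (mset_set I)))"
        "v \<in> set_mset (image_mset x (mset_set I))" for u v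
      using that assms(1) f le by auto
  qed
  moreover have "image_mset f (image_mset x (mset_set I)) = image_mset y (mset_set I)"
    unfolding multiset.map_comp using assms(1) f by (intro image_mset_cong) auto
  ultimately show ?thesis by (simp add: f)
qed

text \<open>Undoing a move raises the remaining parts by one and leaves \<open>a\<close> parts;
  after lowering everything by one, the next choice is bounded by the part just chosen.\<close>

lemma card_ancestors_eq_plays:
  assumes "0 \<notin># q" "q \<noteq> {#}" "2 * i \<le> size q"
  shows "card (ancestors i q) = plays i q (Suc (size q))"
  using assms
proof (induction i arbitrary: q)
  case 0
  then have "ancestors 0 q = {q}" by (auto simp: ancestors_def)
  then show ?case by simp
next
  case (Suc i)
  have "card (ancestors i (unplay q a)) = plays i (q - {#a#}) a"
    if a: "a \<in># q" "size q \<le> Suc a" for a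
  proof -
    have size: "size (unplay q a) = a" using a by (rule size_unplay)
    have "a > 0" using a(1) Suc.prems(1) by (metis gr0I)
    then have "unplay q a \<noteq> {#}" using size by auto
    then have "card (ancestors i (unplay q a)) = plays i (unplay q a) (Suc a)"
      using Suc.IH[of "unplay q a"] a Suc.prems(3) by (simp add: size zero_notin_unplay)
    also have "\<dots> = plays i (image_mset Suc (q - {#a#} + replicate_mset (Suc a - size q) 0)) (Suc a)"
      by (simp add: unplay_def)
    also have "\<dots> = plays i (q - {#a#} + replicate_mset (Suc a - size q) 0) a"
      by (rule plays_image) auto
    \<comment> \<open>The new ones have become zeros, and \<open>a \<ge> 2 * i + 1\<close> keeps
      them out of reach for \<open>i\<close> moves.\<close>
    also have "\<dots> = plays i (q - {#a#}) a"
      using a(2) Suc.prems(3) by (intro plays_cong_large) (auto simp: filter_mset_eq_conv)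
    finally show ?thesis .
  qed
  then show ?case
    by (simp add: card_ancestors_Suc[OF Suc.prems(1,2)])
qed


section \<open>Partitions associated with words\<close>

definition bead :: "letter \<Rightarrow> nat" where
  "bead b = (if b = B then 1 else 0)"

text \<open>Keeping a possible zero part makes the size equal to the length and the equations at
  both ends of a word uniform.\<close>

definition raw_parts :: "word \<Rightarrow> nat multiset" where
  "raw_parts w = mset (map (\<lambda>i. length w - 1 - i + bead (w ! i)) [0..<length w])"

lemma word_partition_raw: "word_partition w = filter_mset (\<lambda>x. x > 0) (raw_parts w)"
  unfolding word_partition_def raw_parts_def bead_def ..

lemma raw_parts_Nil [simp]: "raw_parts [] = {#}"
  by (simp add: raw_parts_def)

lemma raw_parts_Cons [simp]: "raw_parts (b # w) = add_mset (length w + bead b) (raw_parts w)"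
  by (simp add: raw_parts_def map_upt_Suc del: upt_Suc)

lemma raw_parts_snoc: "raw_parts (w @ [b]) = add_mset (bead b) (image_mset Suc (raw_parts w))"
  by (induction w) auto

lemma size_raw_parts [simp]: "size (raw_parts w) = length w"
  by (simp add: raw_parts_def)

lemma word_partition_snoc:
  "word_partition (w @ [b]) = image_mset Suc (raw_parts w) + replicate_mset (bead b) 1"
  by (simp add: word_partition_raw raw_parts_snoc filter_mset_eq_conv bead_def)

lemma size_word_partition_snoc: "size (word_partition (w @ [b])) = length w + bead b"
  by (simp add: word_partition_snoc)

text \<open>The number of parts is exactly the part that \<open>b\<close> contributes in front of
  \<open>w\<close>, so a move rotates the word by one letter.\<close>

lemma bulgarian_word_partition_snoc: "bulgarian (word_partition (w @ [b])) = word_partition (b # w)"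
proof -
  have "image_mset (\<lambda>x. x - 1) (word_partition (w @ [b])) = raw_parts w + replicate_mset (bead b) 0"
    by (simp add: word_partition_snoc multiset.map_comp o_def)
  then show ?thesis
    unfolding bulgarian_def size_word_partition_snoc word_partition_raw[of "b # w"]
    by (simp add: filter_mset_eq_conv bead_def)
qed

lemma sum_word_partition: "sum_mset (word_partition w) = word_weight w"
proof -
  have "sum_mset (filter_mset (\<lambda>x. x > 0) q) = sum_mset q" for q :: "nat multiset"
    by (induction q) auto
  moreover have "sum_mset (raw_parts w) = word_weight w"
    by (induction w) (auto simp: word_weight_def bead_def numeral_2_eq_2)
  ultimately show ?thesis by (simp add: word_partition_raw)
qed

text \<open>For a given length, the number of parts reveals the last letter, which can then be
  stripped.\<close>

lemma word_partition_inj: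
  "length v = length w \<Longrightarrow> word_partition v = word_partition w \<Longrightarrow> v = w"
proof (induction w arbitrary: v rule: rev_induct)
  case (snoc b w)
  obtain u a where v: "v = u @ [a]"
    using snoc.prems(1) by (cases v rule: rev_cases) auto
  with snoc.prems have len: "length u = length w" by simp
  have "bead a = bead b"
    using arg_cong[OF snoc.prems(2), of size] len by (simp add: v size_word_partition_snoc)
  moreover from this have "image_mset Suc (raw_parts u) = image_mset Suc (raw_parts w)"
    using snoc.prems(2) by (simp add: v word_partition_snoc)
  then have "raw_parts u = raw_parts w"
    using multiset.inj_map[of Suc] by (simp add: inj_eq)
  then have "u = w" using snoc.IH[OF len] by (simp add: word_partition_raw)
  moreover have "a = b" using \<open>bead a = bead b\<close> by (cases a; cases b) (auto simp: bead_def)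
  ultimately show ?case by (simp add: v)
qed simp

text \<open>The initial bound \<open>length w + bead (last w)\<close> looks like a part one position
  before the first letter of the cyclic word. A zero part is out of reach.\<close>

lemma card_ancestors_word_partition:
  assumes "w \<noteq> []" "2 * i < length w"
  shows "card (ancestors i (word_partition w)) = plays i (raw_parts w) (length w + bead (last w))"
proof -
  obtain u b where w: "w = u @ [b]" using assms(1) by (cases w rule: rev_cases) auto
  have size: "Suc (size (word_partition w)) = length w + bead (last w)"
    by (simp add: w size_word_partition_snoc)
  show ?thesis
  proof (cases "word_partition w = {#}")
    \<comment> \<open>This happens only for the word \<open>[W]\<close>.\<close>
    case True
    then have "i = 0" using size assms(2) by simp
    moreover have "ancestors 0 {#} = {{#}}" by (auto simp: ancestors_def)
    ultimately show ?thesis by (simp add: True)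
  next
    case False
    have "card (ancestors i (word_partition w)) =
          plays i (word_partition w) (Suc (size (word_partition w)))"
      using False assms(2) size by (intro card_ancestors_eq_plays) (auto simp: word_partition_raw)
    also have "\<dots> = plays i (raw_parts w) (Suc (size (word_partition w)))"
      using assms(2) size
      by (intro plays_cong_large) (auto simp: word_partition_raw filter_filter_mset intro!: filter_mset_cong)
    finally show ?thesis by (simp add: size)
  qed
qed


section \<open>Levels\<close>

lemma self_in_necklace: "w \<in> necklace w"
  by (auto simp: necklace_def rotation_rel_def intro: exI[of _ 0])

lemma necklace_rotate: "necklace (rotate i w) = necklace w"
  unfolding necklace_def
  by (rule equiv_class_eq[OF equiv_rotation_rel, symmetric]) (auto simp: rotation_rel_def)

lemma length_necklace: "v \<in> necklace w \<Longrightarrow> length v = length w"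
  by (auto simp: necklace_def rotation_rel_def)

lemma snoc_necklace_Cons: "u @ [b] \<in> necklace w \<Longrightarrow> b # u \<in> necklace w"
proof -
  have "necklace (u @ [b]) = necklace (b # u)"
    using necklace_rotate[of 1 "b # u"] by simp
  moreover assume "u @ [b] \<in> necklace w"
  then obtain i where "u @ [b] = rotate i w"
    by (auto simp: necklace_def rotation_rel_def)
  then have "necklace (u @ [b]) = necklace w"
    by (simp add: necklace_rotate)
  ultimately show ?thesis using self_in_necklace by blast
qed

lemma bulgarian_cycle:
  assumes "p \<in> cycle (necklace w)"
  shows "bulgarian p \<in> cycle (necklace w)"
proof -
  obtain v where v: "v \<in> necklace w" "p = word_partition v"
    using assms by (auto simp: cycle_def)
  show ?thesis
  proof (cases v rule: rev_cases)
    case Nil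
    then have "bulgarian p = p" by (simp add: v bulgarian_def word_partition_raw)
    then show ?thesis using assms by simp
  next
    case (snoc u b)
    then show ?thesis
      using v snoc_necklace_Cons by (auto simp: cycle_def bulgarian_word_partition_snoc)
  qed
qed

lemma funpow_bulgarian_cycle_mono:
  "i \<le> j \<Longrightarrow> (bulgarian ^^ i) p \<in> cycle (necklace w) \<Longrightarrow> (bulgarian ^^ j) p \<in> cycle (necklace w)"
  by (induction j rule: dec_induct) (auto simp: bulgarian_cycle)

text \<open>A play that has entered the cycle stays there, so counting levels up to \<open>i\<close>
  needs no minimality.\<close>

lemma orbit_level_le:
  "{p \<in> orbit (necklace w). level (necklace w) p \<le> i} =
   {p. 0 \<notin># p \<and> (bulgarian ^^ i) p \<in> cycle (necklace w)}"
proof (intro equalityI subsetI)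
  fix p assume "p \<in> {p \<in> orbit (necklace w). level (necklace w) p \<le> i}"
  then obtain j where "0 \<notin># p" "level (necklace w) p \<le> i" "(bulgarian ^^ j) p \<in> cycle (necklace w)"
    by (auto simp: orbit_def is_partition_def)
  moreover from this have "(bulgarian ^^ level (necklace w) p) p \<in> cycle (necklace w)"
    unfolding level_def by (metis LeastI)
  ultimately show "p \<in> {p. 0 \<notin># p \<and> (bulgarian ^^ i) p \<in> cycle (necklace w)}"
    using funpow_bulgarian_cycle_mono by blast
next
  fix p assume p: "p \<in> {p. 0 \<notin># p \<and> (bulgarian ^^ i) p \<in> cycle (necklace w)}"
  then obtain v where v: "v \<in> necklace w" "(bulgarian ^^ i) p = word_partition v"
    by (auto simp: cycle_def)
  have "sum_mset p = word_weight v"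
    using p v(2) by (metis (mono_tags, lifting) mem_Collect_eq sum_funpow_bulgarian sum_word_partition)
  \<comment> \<open>The orbit asks for at least one move, so \<open>Suc i\<close> is the witness
    that also covers \<open>i = 0\<close>.\<close>
  moreover have "(bulgarian ^^ Suc i) p \<in> cycle (necklace w)"
    using p funpow_bulgarian_cycle_mono[of i "Suc i" p w] by (simp del: funpow.simps)
  moreover have "level (necklace w) p \<le> i"
    unfolding level_def using p by (intro Least_le) simp
  ultimately show "p \<in> {p \<in> orbit (necklace w). level (necklace w) p \<le> i}"
    using p v(1) unfolding orbit_def is_partition_def
    by (auto intro!: bexI[of _ v] exI[of _ "Suc i"] simp del: funpow.simps)
qed

text \<open>Distinct words of a necklace give distinct partitions, whose sets of ancestors are
  disjoint.\<close>

lemma card_orbit_level_le: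
  "card {p \<in> orbit (necklace w). level (necklace w) p \<le> i} =
   (\<Sum>v\<in>necklace w. card (ancestors i (word_partition v)))"
proof -
  have inj: "inj_on word_partition (necklace w)"
    by (auto intro!: inj_onI word_partition_inj simp: length_necklace)
  have fin: "finite (necklace w)"
    by (rule finite_subset[OF _ finite_lists_length_eq[of UNIV "length w"]])
       (auto simp: length_necklace intro: finite_subset[of _ "{B, W}"] letter.exhaust)
  have "{p \<in> orbit (necklace w). level (necklace w) p \<le> i} =
        (\<Union>v\<in>necklace w. ancestors i (word_partition v))"
    unfolding orbit_level_le by (auto simp: ancestors_def cycle_def)
  also have "card \<dots> = (\<Sum>v\<in>necklace w. card (ancestors i (word_partition v)))"
  proof (rule card_UN_disjoint)
    show "\<forall>u\<in>necklace w. \<forall>v\<in>necklace w. u \<noteq> v \<longrightarrow>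
      ancestors i (word_partition u) \<inter> ancestors i (word_partition v) = {}"
      using inj by (auto simp: ancestors_def inj_on_def)
  qed (auto simp: fin finite_ancestors)
  finally show ?thesis .
qed

lemma level_gf_nth:
  "fps_nth (level_gf (necklace w)) i =
   int (card {p \<in> orbit (necklace w). level (necklace w) p \<le> i}) -
   (if i = 0 then 0 else int (card {p \<in> orbit (necklace w). level (necklace w) p \<le> i - 1}))"
proof -
  let ?O = "orbit (necklace w)" and ?l = "level (necklace w)"
  have fin: "finite {p \<in> ?O. Q p}" for Q using finite_orbit by simp
  have nth: "fps_nth (level_gf (necklace w)) i = int (card {p \<in> ?O. ?l p = i})"
  proof -
    have "fps_nth (level_gf (necklace w)) i = (\<Sum>p\<in>?O. if ?l p = i then 1 else 0)"
      by (simp add: level_gf_def fps_sum_nth fps_X_power_nth eq_commute)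
    also have "\<dots> = int (card {p \<in> ?O. ?l p = i})"
      using finite_orbit by (simp add: sum.If_cases Int_def)
    finally show ?thesis .
  qed
  show ?thesis
  proof (cases i)
    case (Suc j)
    have "{p \<in> ?O. ?l p \<le> Suc j} = {p \<in> ?O. ?l p = Suc j} \<union> {p \<in> ?O. ?l p \<le> j}"
      by auto
    then have "card {p \<in> ?O. ?l p \<le> Suc j} = card {p \<in> ?O. ?l p = Suc j} + card {p \<in> ?O. ?l p \<le> j}"
      by (simp add: card_Un_disjoint fin disjoint_iff)
    then show ?thesis unfolding nth by (simp add: Suc)
  next
    case 0
    then show ?thesis unfolding nth by simp
  qed
qed


section \<open>Powers of words\<close>

lemma length_word_power [simp]: "length (word_power w l) = l * length w"
  by (induction l) (auto simp: word_power_def)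

lemma word_power_Suc [simp]: "word_power w (Suc l) = w @ word_power w l"
  by (simp add: word_power_def)

lemma word_power_0 [simp]: "word_power w 0 = []"
  by (simp add: word_power_def)

lemma nth_word_power: "i < l * length w \<Longrightarrow> word_power w l ! i = w ! (i mod length w)"
proof (induction l arbitrary: i)
  case (Suc l)
  then show ?case by (cases "i < length w") (auto simp: nth_append le_mod_geq)
qed simp

text \<open>Rotating a power rotates each period, so the shift matters only modulo
  \<open>length w\<close>.\<close>

lemma necklace_word_power:
  "w \<noteq> [] \<Longrightarrow> necklace (word_power w l) = (\<lambda>r. word_power (rotate r w) l) ` {..<length w}"
proof (intro equalityI subsetI)
  fix v assume "w \<noteq> []" "v \<in> necklace (word_power w l)"
  then obtain r where "v = rotate r (word_power w l)"
    by (auto simp: necklace_def rotation_rel_def)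
  then have "v = word_power (rotate (r mod length w) w) l"
    by (simp add: word_power_rotate flip: rotate_conv_mod)
  then show "v \<in> (\<lambda>r. word_power (rotate r w) l) ` {..<length w}"
    using \<open>w \<noteq> []\<close> by auto
qed (auto simp: necklace_def rotation_rel_def word_power_rotate)

text \<open>The only place where a letter equals its cyclic successor marks the rotation: in
  \<open>rotate r w\<close> it sits at \<open>e - r\<close> modulo the length.\<close>

lemma inj_on_rotate_unique_repetition:
  assumes "e < length w"
    and unique: "\<And>d. d < length w \<Longrightarrow> w ! d = w ! (Suc d mod length w) \<longleftrightarrow> d = e"
  shows "inj_on (\<lambda>r. rotate r w) {..<length w}"
proof (rule inj_onI)
  let ?n = "length w"
  have n: "?n > 0" using assms(1) by linarith
  have shift: "(r + i) mod ?n = e" if "rotate r w ! i = rotate r w ! (Suc i mod ?n)" "i < ?n" for r i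
  proof -
    have "(r + Suc i mod ?n) mod ?n = Suc ((r + i) mod ?n) mod ?n"
      by (simp add: mod_simps)
    then show ?thesis
      using that n unique[of "(r + i) mod ?n"] by (simp add: nth_rotate)
  qed
  fix r s assume rs: "r \<in> {..<?n}" "s \<in> {..<?n}" "rotate r w = rotate s w"
  define i where "i = (e + (?n - r)) mod ?n"
  have i: "i < ?n" using n by (simp add: i_def)
  have ri: "(r + i) mod ?n = e"
    using rs(1) assms(1) by (simp add: i_def mod_simps)
  have "(r + Suc i mod ?n) mod ?n = Suc ((r + i) mod ?n) mod ?n"
    by (simp add: mod_simps)
  then have "rotate r w ! i = rotate r w ! (Suc i mod ?n)"
    using n i ri unique[of e] assms(1) by (simp add: nth_rotate)
  then have "(s + i) mod ?n = e" using shift[of s i] rs(3) i by simp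
  then have "(r + i) mod ?n = (s + i) mod ?n" using ri by simp
  moreover have "x = ((x + i) mod ?n + (?n - i)) mod ?n" if "x < ?n" for x
  proof -
    have "((x + i) mod ?n + (?n - i)) mod ?n = (x + i + (?n - i)) mod ?n"
      by (rule mod_add_left_eq)
    also have "\<dots> = x" using that i by simp
    finally show ?thesis by simp
  qed
  ultimately show "r = s" using rs(1,2) by (metis lessThan_iff)
qed

text \<open>As \<open>l > 0\<close>, the first period of the power recovers the rotation.\<close>

lemma sum_necklace_word_power:
  assumes "w \<noteq> []" "l > 0" "inj_on (\<lambda>r. rotate r w) {..<length w}"
  shows "(\<Sum>v\<in>necklace (word_power w l). f v) = (\<Sum>r<length w. f (word_power (rotate r w) l))"
proof -
  have "take (length w) (word_power (rotate r w) l) = rotate r w" for r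
    using assms(2) by (cases l) auto
  then have "inj_on (\<lambda>r. word_power (rotate r w) l) {..<length w}"
    using assms(3) unfolding inj_on_def by metis
  then show ?thesis by (simp add: necklace_word_power[OF assms(1)] sum.reindex)
qed

text \<open>Indices start at 1 so that 0 stays free for the preceding choice.\<close>

lemma raw_parts_indexed:
  "raw_parts w = image_mset (\<lambda>j. length w - j + bead (w ! (j - 1))) (mset_set {1..length w})"
proof -
  have "mset_set {1..length w} = image_mset Suc (mset_set {0..<length w})"
    by (subst image_mset_mset_set) (auto simp: atLeastLessThanSuc_atLeastAtMost)
  then show ?thesis
    by (simp add: raw_parts_def multiset.map_comp o_def)
qed


section \<open>Alternating words\<close>

definition alt :: "letter \<Rightarrow> nat \<Rightarrow> word" where
  "alt b k = b # word_power [W, B] k"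

lemma length_alt [simp]: "length (alt b k) = Suc (2 * k)"
  by (simp add: alt_def)

lemma alt_nonempty [simp]: "alt b k \<noteq> []"
  by (simp add: alt_def)

lemma nth_alt: "e < Suc (2 * k) \<Longrightarrow> alt b k ! e = (if e = 0 then b else if even e then B else W)"
proof (cases e)
  case (Suc d)
  moreover assume "e < Suc (2 * k)"
  ultimately have "alt b k ! e = [W, B] ! (d mod 2)"
    by (simp add: alt_def nth_word_power numeral_2_eq_2)
  then show ?thesis using Suc by (cases "even d") (simp_all add: mod_2_eq_odd)
qed (simp add: alt_def)

lemma inj_on_rotate_alt:
  assumes "k \<ge> 1"
  shows "inj_on (\<lambda>r. rotate r (alt b k)) {..<length (alt b k)}"
proof (rule inj_on_rotate_unique_repetition)
  \<comment> \<open>The repetition is the final \<open>B\<close> followed cyclically by the initial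
    \<open>B\<close>, or the \<open>W W\<close> at the start.\<close>
  let ?e = "if b = B then 2 * k else 0"
  show "?e < length (alt b k)" by simp
  show "alt b k ! d = alt b k ! (Suc d mod length (alt b k)) \<longleftrightarrow> d = ?e"
    if "d < length (alt b k)" for d
    using that assms by (cases b) (auto simp: nth_alt mod_Suc)
qed

text \<open>
  Position \<open>g\<close> of the infinite periodic word with period \<open>alt b k\<close> carries, up to a constant, the part
  \<open>s b g - g\<close>.
\<close>

lemma alt_order:
  assumes "k \<ge> 1"
  defines "s \<equiv> \<lambda>b g. int (bead (alt b k ! (g mod Suc (2 * k))))"
  shows "s B g - int g = s B h - int h \<longleftrightarrow> s W g - int g = s W h - int h"
    and "s B g - int g \<le> s B h - int h + 2 \<longleftrightarrow> s W g - int g \<le> s W h - int h + 2"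
proof -
  have s: "s b g = (if g mod Suc (2 * k) = 0 then int (bead b) else if even (g mod Suc (2 * k)) then 1 else 0)"
    for b g unfolding s_def by (auto simp: nth_alt bead_def)
  have le: "s b g \<le> 1" "0 \<le> s b g" for b g by (auto simp: s bead_def)
  \<comment> \<open>All comparisons reduce to these relations, and the flipped letter never decides
    them: at distances 1 and 3 it meets \<open>B\<close> before and \<open>W\<close> after it, at
    distance 2 \<open>W\<close> before and \<open>B\<close> after. For \<open>k = 1\<close>,
    distance 3 leads back to the flipped letter.\<close>
  have steps: "(s B (Suc g) - s B g = 1 \<longleftrightarrow> s W (Suc g) - s W g = 1) \<and>
    (s B g \<le> s B (g + 2) \<longleftrightarrow> s W g \<le> s W (g + 2)) \<and>
    (s B (g + 3) - s B g = 1 \<longleftrightarrow> s W (g + 3) - s W g = 1)" for g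
  proof -
    define e where "e = g mod Suc (2 * k)"
    have e: "e \<le> 2 * k" using mod_less_divisor[of "Suc (2 * k)" g] by (simp add: e_def)
    have m: "g + 2 = Suc (Suc g)" "g + 3 = Suc (Suc (Suc g))" by auto
    have bead: "bead B = 1" "bead W = 0" by (auto simp: bead_def)
    consider "e + 3 \<le> 2 * k" | "e + 2 = 2 * k" | "e + 1 = 2 * k" | "e = 2 * k"
      using e by linarith
    then show ?thesis
      unfolding s m mod_Suc e_def[symmetric] bead
      using assms(1) by (cases; auto; presburger)
  qed
  \<comment> \<open>Beads are 0 or 1, so equal values occur only at distance at most 1.\<close>
  have eq: "s b g - int g = s b h - int h \<longleftrightarrow>
      g = h \<or> (h = Suc g \<and> s b (Suc g) - s b g = 1) \<or> (g = Suc h \<and> s b (Suc h) - s b h = 1)" for b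
  proof -
    consider "g = h" | "h = Suc g" | "g = Suc h" | "h > Suc g" | "g > Suc h" by linarith
    then show ?thesis using le[of b g] le[of b h] by cases auto
  qed
  show "s B g - int g = s B h - int h \<longleftrightarrow> s W g - int g = s W h - int h"
    using steps[of g] steps[of h] unfolding eq by blast
  \<comment> \<open>For the same reason only \<open>h = g + 2\<close> and \<open>h = g + 3\<close>
    depend on the beads.\<close>
  have le2: "s b g - int g \<le> s b h - int h + 2 \<longleftrightarrow>
      h \<le> g + 1 \<or> (h = g + 2 \<and> s b g \<le> s b (g + 2)) \<or> (h = g + 3 \<and> s b (g + 3) - s b g = 1)" for b
  proof -
    consider "h \<le> g + 1" | "h = g + 2" | "h = g + 3" | "h > g + 3" by linarith
    then show ?thesis using le[of b g] le[of b h] by cases auto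
  qed
  show "s B g - int g \<le> s B h - int h + 2 \<longleftrightarrow> s W g - int g \<le> s W h - int h + 2"
    using steps[of g] unfolding le2 by blast
qed

lemma card_ancestors_alt:
  assumes "k \<ge> 1" "l > 2 * i"
  shows "card (ancestors i (word_partition (word_power (rotate r (alt B k)) l))) =
         card (ancestors i (word_partition (word_power (rotate r (alt W k)) l)))"
proof -
  let ?p = "Suc (2 * k)"
  define m where "m = l * ?p"
  have m: "m > 0" "2 * i < m" using assms by (auto simp: m_def)
  \<comment> \<open>Index \<open>j\<close> belongs to position \<open>r + j - 1\<close>. Adding one
    period gives index 0 a natural number too, whose letter is the last one of the word.\<close>
  define g where "g j = r + 2 * k + j" for j
  define x where "x b j = m - j + bead (alt b k ! (g j mod ?p))" for b j
  have card: "card (ancestors i (word_partition (word_power (rotate r (alt b k)) l))) =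
      plays i (image_mset (x b) (mset_set {1..m})) (x b 0)" for b
  proof -
    let ?w = "word_power (rotate r (alt b k)) l"
    have len: "length ?w = m" by (simp add: m_def)
    then have ne: "?w \<noteq> []" using m by (metis length_0_conv less_not_refl)
    have nth: "?w ! j = alt b k ! ((r + j) mod ?p)" if "j < m" for j
      using that by (simp add: nth_word_power nth_rotate m_def mod_simps)
    have "last ?w = alt b k ! (g 0 mod ?p)"
    proof -
      have "r + (m - 1) = r + 2 * k + (l - 1) * ?p"
        using assms by (cases l) (auto simp: m_def)
      then have "(r + (m - 1)) mod ?p = g 0 mod ?p" unfolding g_def
        by (metis add_0_right mod_mult_self1)
      moreover have "last ?w = ?w ! (m - 1)" unfolding last_conv_nth[OF ne] len ..
      ultimately show ?thesis using nth[of "m - 1"] m by simp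
    qed
    moreover have "?w ! (j - 1) = alt b k ! (g j mod ?p)" if "j \<in> {1..m}" for j
    proof -
      have "g j = r + (j - 1) + ?p" using that by (simp add: g_def)
      then have "g j mod ?p = (r + (j - 1)) mod ?p" by (metis mod_add_self2)
      then show ?thesis using nth[of "j - 1"] that by auto
    qed
    moreover from this have "raw_parts ?w = image_mset (x b) (mset_set {1..m})"
      unfolding raw_parts_indexed len x_def by (intro image_mset_cong) auto
    ultimately show ?thesis
      using card_ancestors_word_partition[OF ne, of i] m(2) unfolding len by (simp add: x_def)
  qed
  \<comment> \<open>The last summand does not depend on \<open>j\<close> and cancels in every
    comparison, leaving the values of \<open>alt_order\<close>.\<close>
  have xint: "int (x b j) = int (bead (alt b k ! (g j mod ?p))) - int (g j) + int (m + r + 2 * k)"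
    if "j \<le> m" for b j
    using that by (simp add: x_def g_def of_nat_diff)
  show ?thesis unfolding card
  proof (rule plays_cong_indexed)
    fix a c assume ac: "a \<in> insert 0 {1..m}" "c \<in> insert 0 {1..m}"
    then have le: "a \<le> m" "c \<le> m" by auto
    define y where "y b j = int (bead (alt b k ! (g j mod ?p))) - int (g j)" for b j
    have "x b a = x b c \<longleftrightarrow> y b a = y b c" "x b a \<le> x b c + 2 \<longleftrightarrow> y b a \<le> y b c + 2" for b
      using xint[OF le(1), of b] xint[OF le(2), of b] unfolding y_def[symmetric] by linarith+
    then show "x B a = x B c \<longleftrightarrow> x W a = x W c" "x B a \<le> x B c + 2 \<longleftrightarrow> x W a \<le> x W c + 2"
      using alt_order[OF assms(1), of "g a" "g c"] unfolding y_def by simp_all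
  qed simp
qed

text \<open>The coefficient is a difference of counts of levels up to \<open>i\<close> and
  \<open>i - 1\<close>; both are compared rotation by rotation.\<close>

lemma level_gf_alt:
  assumes "k \<ge> 1" "l > 2 * i"
  shows "fps_nth (level_gf (necklace (word_power (alt B k) l))) i =
         fps_nth (level_gf (necklace (word_power (alt W k) l))) i"
proof -
  have "card {p \<in> orbit (necklace (word_power (alt B k) l)). level (necklace (word_power (alt B k) l)) p \<le> j} =
        card {p \<in> orbit (necklace (word_power (alt W k) l)). level (necklace (word_power (alt W k) l)) p \<le> j}"
    if "j \<le> i" for j
    using assms that
    unfolding card_orbit_level_le
    by (subst (1 2) sum_necklace_word_power) (simp_all add: inj_on_rotate_alt card_ancestors_alt del: length_alt, simp)
  then show ?thesis by (simp add: level_gf_nth)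
qed

text \<open>\<open>lim\<close> is a description of the limit, and both sequences have the same
  limits; divergent sequences are covered.\<close>

lemma lim_eq_if_eventually_eq:
  assumes "\<forall>\<^sub>F l in sequentially. f l = g l"
  shows "lim f = lim g"
  using tendsto_cong[OF assms] by (simp add: lim_def)

text \<open>Moving the first letter of \<open>alt W k\<close> to the end gives
  \<open>(WB)^k W\<close>, which reads \<open>W (BW)^k\<close>.\<close>

lemma necklace_alt_W: "necklace (W # word_power [B, W] k) = necklace (alt W k)"
proof -
  have "word_power [W, B] k @ [W] = W # word_power [B, W] k" for k
    by (induction k) auto
  then show ?thesis using necklace_rotate[of 1 "alt W k"] by (simp add: alt_def)
qed

theorem theorem1p2:
  fixes k :: nat
  assumes "k \<ge> 1"
  shows "limit_gf (necklace (B # word_power [W, B] k)) =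
         limit_gf (necklace (W # word_power [B, W] k))"
proof -
  have "lim (\<lambda>l. fps_nth (level_gf (necklace_power (necklace (alt B k)) l)) i) =
        lim (\<lambda>l. fps_nth (level_gf (necklace_power (necklace (alt W k)) l)) i)" for i
    unfolding necklace_power_necklace
    by (intro lim_eq_if_eventually_eq eventually_mono[OF eventually_gt_at_top[of "2 * i"]])
       (rule level_gf_alt[OF assms])
  then have "limit_gf (necklace (alt B k)) = limit_gf (necklace (alt W k))"
    by (simp add: limit_gf_def)
  then show ?thesis by (simp add: necklace_alt_W alt_def)
qed

end
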